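(* Let $1 \le m \le n$, let $f:\mathbb{R}^n\to\mathbb{R}$ and $g=(g_1,\dots,g_m):\mathbb{R}^n\to\mathbb{R}^m$ be $C^2$ functions, and suppose that $0\in\mathbb{R}^m$ is a regular value of $g$, i.e. the Jacobian matrix $J g(x)\in\mathbb{R}^{m\times n}$ has full rank $m$ for every $x\in \mathcal{M}_g=\{x\in\mathbb{R}^n \mid g(x)=0\}$. Let $x^*\in\mathcal{M}_g$ be a local minimum of $f$ restricted to $\mathcal{M}_g$, with $\nabla f(x^* )\neq 0$, and let $\lambda^*=(\lambda_1^*,\dots,\lambda_m^* )\in\mathbb{R}^m$ be the Lagrange multipliers vector associated to $x^*$, i.e. the vector satisfying $\nabla f(x^* )-\sum_{i=1}^m\lambda_i^*\nabla g_i(x^* )=0$. Then the second-order optimality conditions $$v^T\Big(\nabla^2 f(x^* )-\sum_{i=1}^m\lambda_i^*\nabla^2 g_i(x^* )\Big)v\ \ge\ 0\qquad \forall\, v\in \mathrm{Ker}(J g(x^* ))$$ are equivalent to $$\langle \nu_f(x^* ),\,h_{f,x^*}(v,v)\rangle\ \le\ \langle \nu_f(x^* ),\,h_{g,x^*}(v,v)\rangle\qquad \forall\, v\in \mathrm{Ker}(J g(x^* ))=T_{x^*}\mathcal{M}_g,$$ where $\nu_f(x^* )=\nabla f(x^* )/\|\nabla f(x^* )\|$, and $h_{f,x^*}$ and $h_{g,x^*}$ are the second fundamental forms at $x^*$ of the hypersurface $\mathcal{M}_{f,x^*}=\{x\in\mathbb{R}^n\mid f(x)=f(x^* )\}$ and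 of the submanifold $\mathcal{M}_g$, respectively.
   Context: Local minimum: $x^*\in\mathcal{M}_g$ and there is a neighbourhood $U$ of $x^*$ in $\mathbb{R}^n$ such that $f(x)\ge f(x^* )$ for all $x\in U\cap\mathcal{M}_g$. $\nabla f,\nabla g_i$ are gradients (column vectors), $\nabla^2 f,\nabla^2 g_i$ are Hessian matrices, and $\langle\cdot,\cdot\rangle$, $\|\cdot\|$ are the Euclidean inner product and norm on $\mathbb{R}^n$. Submanifolds: since $0$ is a regular value of $g$, $\mathcal{M}_g$ is an embedded $(n-m)$-dimensional submanifold of $\mathbb{R}^n$ with $T_x\mathcal{M}_g=\mathrm{Ker}(J g(x))$. Since $\nabla f(x^* )\ne 0$, $\mathcal{M}_{f,x^*}$ is, near $x^*$, an embedded hypersurface with $T_x\mathcal{M}_{f,x^*}=\{v\in\mathbb{R}^n\mid\nabla f(x)^Tv=0\}$. The first-order condition gives $T_{x^*}\mathcal{M}_g\subseteq T_{x^*}\mathcal{M}_{f,x^*}$, so $h_{f,x^*}(v,v)$ is defined for every $v\in T_{x^*}\mathcal{M}_g$. Second fundamental form: for a submanifold $\mathcal{M}\subset\mathbb{R}^n$ and $x\in\mathcal{M}$, let $\Pi(x)\in\mathbb{R}^{n\times n}$ be the matrix of the orthogonal projection of $\mathbb{R}^n$ onto $T_x\mathcal{M}$. For $v\in T_x\mathcal{M}$, define $d\Pi(x)v:=(\Pi\circ\gamma)'(0)\in\mathbb{R}^{n\times n}$, where $\gamma:\,]-\epsilon,\epsilon[\,\to\mathbb{R}^n$ ($\epsilon>0$)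 is any differentiable curve with image in $\mathcal{M}$, $\gamma(0)=x$ and $\gamma'(0)=v$. The second fundamental form at $x$ is the symmetric bilinear map $h_x:T_x\mathcal{M}\times T_x\mathcal{M}\to (T_x\mathcal{M})^\perp$, $h_x(u,v)=(d\Pi(x)u)v$. Here $h_{f,x^*}$ is obtained with $\mathcal{M}=\mathcal{M}_{f,x^*}$ (near $x^*$), for which $\Pi_f(x)=I_n-\nu_f(x)\nu_f(x)^T$ with $\nu_f(x)=\nabla f(x)/\|\nabla f(x)\|$, and $h_{g,x^*}$ is obtained with $\mathcal{M}=\mathcal{M}_g$, for which $\Pi_g(x)=I_n-J g(x)^T(J g(x)J g(x)^T)^{-1}J g(x)$. *)

theory Defs
  imports "HOL-Analysis.Analysis"
begin

definition C2 :: "('a::real_normed_vector \<Rightarrow> 'b::real_normed_vector) \<Rightarrow> bool" where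
  "C2 f \<longleftrightarrow>
     (\<exists>(f' :: 'a \<Rightarrow> 'a \<Rightarrow>\<^sub>L 'b) (f'' :: 'a \<Rightarrow> 'a \<Rightarrow>\<^sub>L 'a \<Rightarrow>\<^sub>L 'b).
        (\<forall>x. (f has_derivative blinfun_apply (f' x)) (at x)) \<and>
        (\<forall>x. (f' has_derivative blinfun_apply (f'' x)) (at x)) \<and>
        continuous_on UNIV f'')"

definition gradient :: "(real^'n \<Rightarrow> real) \<Rightarrow> real^'n \<Rightarrow> real^'n" where
  "gradient f x = (THE d. GDERIV f x :> d)"

definition hessian :: "(real^'n \<Rightarrow> real) \<Rightarrow> real^'n \<Rightarrow> real^'n^'n" where
  "hessian f x = jacobian (gradient f) (at x)"

definition regular_value :: "(real^'n \<Rightarrow> real^'m) \<Rightarrow> real^'m \<Rightarrow> bool" where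
  "regular_value g c \<longleftrightarrow> (\<forall>x. g x = c \<longrightarrow> rank (jacobian g (at x)) = CARD('m))"

definition local_min_on :: "('a::topological_space \<Rightarrow> real) \<Rightarrow> 'a set \<Rightarrow> 'a \<Rightarrow> bool" where
  "local_min_on f S x \<longleftrightarrow> x \<in> S \<and> (\<exists>U. open U \<and> x \<in> U \<and> (\<forall>y\<in>U \<inter> S. f y \<ge> f x))"

definition unit_normal :: "(real^'n \<Rightarrow> real) \<Rightarrow> real^'n \<Rightarrow> real^'n" where
  "unit_normal f x = gradient f x /\<^sub>R norm (gradient f x)"

text \<open>A differentiable curve in \<open>M\<close> through \<open>x\<close> with velocity \<open>v\<close>. Curves are total functions,
  but only their values on some interval around \<open>0\<close> are constrained.\<close>

definition curve_through ::
    "(real^'n) set \<Rightarrow> real^'n \<Rightarrow> real^'n \<Rightarrow> (real \<Rightarrow> real^'n) \<Rightarrow> bool" where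
  "curve_through M x v \<gamma> \<longleftrightarrow>
     (\<exists>\<epsilon>>0. \<forall>t\<in>{-\<epsilon><..<\<epsilon>}. \<gamma> t \<in> M \<and> \<gamma> differentiable (at t)) \<and>
     \<gamma> 0 = x \<and> (\<gamma> has_vector_derivative v) (at 0)"

definition tangent_space :: "(real^'n) set \<Rightarrow> real^'n \<Rightarrow> (real^'n) set" where
  "tangent_space M x = {v. \<exists>\<gamma>. curve_through M x v \<gamma>}"

definition orth_proj_matrix :: "(real^'n) set \<Rightarrow> real^'n^'n" where
  "orth_proj_matrix S = (THE P. \<forall>u. P *v u \<in> S \<and> (\<forall>w\<in>S. orthogonal (u - P *v u) w))"

abbreviation tangent_proj :: "(real^'n) set \<Rightarrow> real^'n \<Rightarrow> real^'n^'n" where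
  "tangent_proj M x \<equiv> orth_proj_matrix (tangent_space M x)"

text \<open>The next two definitions are meant for a set \<open>M\<close> that is, near \<open>x\<close>, an embedded \<open>C\<^sup>2\<close>
  submanifold, and for tangent vectors \<open>u\<close>, \<open>v\<close> at \<open>x\<close>. The derivative of the projection
  along a curve then depends only on the velocity of the curve, and at least one curve exists,
  so the description has a unique solution. Only the part of \<open>M\<close> near \<open>x\<close> matters.\<close>

definition tangent_proj_deriv :: "(real^'n) set \<Rightarrow> real^'n \<Rightarrow> real^'n \<Rightarrow> real^'n^'n" where
  "tangent_proj_deriv M x v =
     (THE D. \<forall>\<gamma>. curve_through M x v \<gamma> \<longrightarrow>
        ((\<lambda>t. tangent_proj M (\<gamma> t)) has_vector_derivative D) (at 0))"

definition second_fundamental_form ::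
    "(real^'n) set \<Rightarrow> real^'n \<Rightarrow> real^'n \<Rightarrow> real^'n \<Rightarrow> real^'n" where
  "second_fundamental_form M x u v = tangent_proj_deriv M x u *v v"

end

theory Submission
  imports Defs
begin

text \<open>
  Both second fundamental forms are tested against one and the same vector, and that vector is
  normal to both submanifolds. For a level set \<open>M\<close> of a \<open>C\<^sup>2\<close> map \<open>F\<close>, a tangent vector \<open>v\<close> at a
  regular point \<open>p\<close>, and a differentiable field \<open>N\<close> that is everywhere orthogonal to the kernel of
  the derivative of \<open>F\<close>,
  \<open>\<langle>N p, h(v, v)\<rangle> = - v\<^sup>T DN(p) v\<close>
  (lemma \<open>normal_inner_second_fundamental_form\<close>). This comes from the product rule: if \<open>P y\<close>
  denotes the orthogonal projection onto the kernel at \<open>y\<close>, then \<open>\<langle>N y, P y v\<rangle>\<close> vanishes near \<open>p\<close>,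
  and its derivative at \<open>p\<close> in direction \<open>v\<close> is \<open>\<langle>DN(p) v, P p v\<rangle> + \<langle>N p, h(v, v)\<rangle>\<close>, where
  \<open>P p v = v\<close>.

  Take \<open>N\<close> to be the gradient of \<open>f\<close> for the hypersurface, and the combination of the gradients of
  the \<open>g\<^sub>i\<close> with constant coefficients \<open>\<lambda>\<^sub>i\<close> for the constraint set. By the multiplier equation the two
  fields agree at the given point, and their derivatives there are the Hessian of \<open>f\<close> and the same
  combination of the Hessians of the \<open>g\<^sub>i\<close>. After division by the norm of the gradient, the
  inequality between the second fundamental forms is, for each single \<open>v\<close>, the second-order
  inequality.

  What remains is to tie the geometric objects to the derivative of \<open>F\<close>. The tangent space,
  defined by velocities of curves, is the kernel of the Jacobian
  (\<open>tangent_space_level_set\<close>, which rests on the inverse function theorem through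
  \<open>curve_in_level_set\<close>). The tangential projection at points of \<open>M\<close> near \<open>p\<close> is therefore given by a
  formula in the entries of the Jacobian that is differentiable at \<open>p\<close> as a map on the ambient space,
  so that its derivative along a curve depends only on the velocity (\<open>tangent_proj_deriv_level_set\<close>).
\<close>

section \<open>Maps of class \<open>C\<^sup>2\<close> and their Jacobian matrices\<close>

text \<open>With \<open>L = vec\<close> this turns a real-valued function into a map to \<open>real^1\<close>, so that
  hypersurfaces and level sets of systems of equations are handled by the same lemmas.\<close>

lemma C2_bounded_linear_compose:
  fixes L :: "'b::real_normed_vector \<Rightarrow> 'c::real_normed_vector"
    and F :: "'a::real_normed_vector \<Rightarrow> 'b"
  assumes "bounded_linear L" and "C2 F"
  shows "C2 (\<lambda>y. L (F y))"
proof -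
  obtain F' F'' where d1: "\<And>y. (F has_derivative blinfun_apply (F' y)) (at y)"
    and d2: "\<And>y. (F' has_derivative blinfun_apply (F'' y)) (at y)"
    and cont: "continuous_on UNIV F''"
    using \<open>C2 F\<close> unfolding C2_def by blast
  define B where "B = Blinfun L"
  have B: "blinfun_apply B = L"
    using assms(1) by (simp add: B_def bounded_linear_Blinfun_apply)
  define C where "C = Blinfun ((o\<^sub>L) B :: ('a \<Rightarrow>\<^sub>L 'b) \<Rightarrow> ('a \<Rightarrow>\<^sub>L 'c))"
  have blC: "bounded_linear ((o\<^sub>L) B :: ('a \<Rightarrow>\<^sub>L 'b) \<Rightarrow> ('a \<Rightarrow>\<^sub>L 'c))"
    by (rule bounded_bilinear.bounded_linear_right[OF bounded_bilinear_blinfun_compose])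
  then have C: "blinfun_apply C = (o\<^sub>L) B"
    by (simp add: C_def bounded_linear_Blinfun_apply)
  have "((\<lambda>y. L (F y)) has_derivative blinfun_apply (B o\<^sub>L F' y)) (at y)" for y
    using bounded_linear.has_derivative[OF assms(1) d1] by (simp add: B blinfun_compose.rep_eq o_def)
  moreover have "((\<lambda>y. B o\<^sub>L F' y) has_derivative blinfun_apply (C o\<^sub>L F'' y)) (at y)" for y
    using bounded_linear.has_derivative[OF blC d2] by (simp add: C blinfun_compose.rep_eq o_def)
  moreover have "continuous_on UNIV (\<lambda>y. C o\<^sub>L F'' y)"
    by (intro continuous_intros cont)
  ultimately show ?thesis
    unfolding C2_def
    by (intro exI[of _ "\<lambda>y. B o\<^sub>L F' y"] exI[of _ "\<lambda>y. C o\<^sub>L F'' y"]) simp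
qed

lemma differentiable_vec_iff:
  fixes B :: "'a::real_normed_vector \<Rightarrow> 'b::euclidean_space^'k"
  shows "B differentiable (at y) \<longleftrightarrow> (\<forall>i. (\<lambda>y. B y $ i) differentiable (at y))"
proof
  show "\<forall>i. (\<lambda>y. B y $ i) differentiable (at y)" if "B differentiable (at y)"
    using differentiable_compose[OF bounded_linear_imp_differentiable[OF bounded_linear_vec_nth] that]
    by blast
next
  assume *: "\<forall>i. (\<lambda>y. B y $ i) differentiable (at y)"
  have bl: "bounded_linear (axis i :: 'b \<Rightarrow> 'b^'k)" for i
    unfolding linear_conv_bounded_linear[symmetric]
    by (rule linearI) (auto simp: axis_def vec_eq_iff)
  have "(\<lambda>y. \<Sum>i\<in>UNIV. axis i (B y $ i)) differentiable (at y)"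
    using * by (intro differentiable_sum ballI finite
        differentiable_compose[OF bounded_linear_imp_differentiable[OF bl]]) blast
  moreover have "(\<Sum>i\<in>UNIV. axis i (B y $ i)) = B y" for y
    by (simp add: vec_eq_iff axis_def)
  ultimately show "B differentiable (at y)" by (simp only:)
qed

lemma differentiable_matrix_iff:
  fixes B :: "'a::real_normed_vector \<Rightarrow> real^'n^'k"
  shows "B differentiable (at y) \<longleftrightarrow> (\<forall>i j. (\<lambda>y. B y $ i $ j) differentiable (at y))"
  by (simp add: differentiable_vec_iff)

lemma C2_has_derivative_jacobian:
  fixes F :: "real^'n \<Rightarrow> real^'k"
  assumes "C2 F"
  shows "(F has_derivative (*v) (jacobian F (at y))) (at y)"
  using assms unfolding C2_def jacobian_works[symmetric]
  by (meson differentiableI)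

lemma C2_jacobian_differentiable:
  fixes F :: "real^'n \<Rightarrow> real^'k"
  assumes "C2 F"
  shows "(\<lambda>y. jacobian F (at y)) differentiable (at y)"
proof -
  obtain F' F'' where d1: "\<And>y. (F has_derivative blinfun_apply (F' y)) (at y)"
    and d2: "\<And>y. (F' has_derivative blinfun_apply (F'' y)) (at y)"
    using assms unfolding C2_def by blast
  have "jacobian F (at y) = matrix (blinfun_apply (F' y))" for y
    unfolding jacobian_def by (simp add: frechet_derivative_at[OF d1, symmetric])
  then have "(\<lambda>y. jacobian F (at y) $ i $ j) = (\<lambda>y. F' y (axis j 1) $ i)" for i j
    by (simp add: matrix_def)
  moreover have "(\<lambda>y. F' y (axis j 1) $ i) differentiable (at y)" for i j
    by (rule differentiableI[OF bounded_linear.has_derivative[OF bounded_linear_vec_nth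
          bounded_linear.has_derivative[OF blinfun.bounded_linear_left d2]]])
  ultimately show ?thesis
    unfolding differentiable_matrix_iff by (simp only:) blast
qed

lemma gradient_eqI:
  assumes "(f has_derivative (\<lambda>h. d \<bullet> h)) (at y)"
  shows "gradient f y = d"
  unfolding gradient_def
proof (rule the_equality)
  show "GDERIV f y :> d"
    using assms by (simp add: gderiv_def inner_commute)
  fix e assume "GDERIV f y :> e"
  then have "(\<lambda>h. h \<bullet> e) = (\<lambda>h. d \<bullet> h)"
    using assms has_derivative_unique unfolding gderiv_def by blast
  then have "h \<bullet> e = h \<bullet> d" for h
    by (metis inner_commute)
  then show "e = d"
    using vector_eq_ldot by blast
qed

lemma has_derivative_jacobian_row:
  fixes F :: "real^'n \<Rightarrow> real^'k"
  assumes "C2 F"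
  shows "((\<lambda>y. F y $ i) has_derivative (\<lambda>h. jacobian F (at y) $ i \<bullet> h)) (at y)"
  using bounded_linear.has_derivative[OF bounded_linear_vec_nth C2_has_derivative_jacobian[OF assms], of i]
  by (simp add: matrix_vector_mul_component)

lemma gradient_component:
  fixes F :: "real^'n \<Rightarrow> real^'k"
  assumes "C2 F"
  shows "gradient (\<lambda>y. F y $ i) y = jacobian F (at y) $ i"
  by (rule gradient_eqI[OF has_derivative_jacobian_row[OF assms]])

text \<open>A \<open>hessian\<close> is by definition the Jacobian of a gradient, which carries information only where
  that gradient is differentiable; here the gradient is a row of a differentiable Jacobian.\<close>

lemma gradient_component_has_derivative:
  fixes F :: "real^'n \<Rightarrow> real^'k"
  assumes "C2 F"
  shows "(gradient (\<lambda>y. F y $ i) has_derivative (*v) (hessian (\<lambda>y. F y $ i) y)) (at y)"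
proof -
  have "(\<lambda>y. jacobian F (at y) $ i) differentiable (at y)"
    using C2_jacobian_differentiable[OF assms, of y] unfolding differentiable_vec_iff by blast
  moreover have "gradient (\<lambda>y. F y $ i) = (\<lambda>y. jacobian F (at y) $ i)"
    using gradient_component[OF assms] by blast
  ultimately show ?thesis
    unfolding hessian_def by (simp add: jacobian_works)
qed

section \<open>Level sets\<close>

text \<open>
  The map \<open>\<Psi> y = (y - p) - R (F' p (y - p)) + R (F y - F p)\<close> replaces the linear part of the
  displacement transversal to the level set by its nonlinear counterpart. Its derivative at \<open>p\<close> is
  the identity, so it has a differentiable local inverse \<open>h\<close>. Because \<open>R\<close> is a right inverse,
  \<open>F' p (\<Psi> y) = F y - F p\<close>: hence \<open>h\<close> sends the kernel of \<open>F' p\<close> into the level set, and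
  \<open>t \<mapsto> h (t v)\<close> is the required curve.
\<close>

lemma curve_in_level_set:
  fixes F :: "'a::euclidean_space \<Rightarrow> 'b::euclidean_space" and F' :: "'a \<Rightarrow> 'a \<Rightarrow>\<^sub>L 'b"
    and R :: "'b \<Rightarrow>\<^sub>L 'a"
  assumes deriv: "\<And>y. (F has_derivative blinfun_apply (F' y)) (at y)"
    and cont: "continuous_on UNIV F'"
    and R: "F' p o\<^sub>L R = id_blinfun"
    and v: "F' p v = 0"
  obtains \<gamma> \<epsilon> where "\<epsilon> > 0" and "\<gamma> 0 = p" and "(\<gamma> has_vector_derivative v) (at 0)"
    and "\<And>t. t \<in> {-\<epsilon><..<\<epsilon>} \<Longrightarrow> F (\<gamma> t) = F p \<and> \<gamma> differentiable (at t)"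
proof -
  have FR: "F' p (R w) = w" for w
    using R by (metis blinfun_apply_blinfun_compose id_blinfun.rep_eq)
  define \<Psi> where "\<Psi> y = (y - p) - R (F' p (y - p)) + R (F y - F p)" for y
  define \<Psi>' where "\<Psi>' y = id_blinfun - (R o\<^sub>L F' p) + (R o\<^sub>L F' y)" for y
  have d\<Psi>: "(\<Psi> has_derivative blinfun_apply (\<Psi>' y)) (at y)" for y
    unfolding \<Psi>_def \<Psi>'_def
    by (rule derivative_eq_intros deriv refl)+
       (simp add: fun_eq_iff blinfun.add_left blinfun.diff_left)
  have c\<Psi>: "continuous_on UNIV \<Psi>'"
    unfolding \<Psi>'_def by (intro continuous_intros cont)
  have \<Psi>'p: "\<Psi>' p = id_blinfun"
    by (simp add: \<Psi>'_def)
  then have "id_blinfun o\<^sub>L \<Psi>' p = id_blinfun"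
    by (simp add: blinfun_eqI)
  from inverse_function_theorem[OF open_UNIV d\<Psi> c\<Psi> UNIV_I this]
  obtain U V h h' where "p \<in> U" "open V" "\<Psi> p \<in> V"
    and hom: "homeomorphism U V \<Psi> h"
    and dh: "\<And>z. z \<in> V \<Longrightarrow> (h has_derivative (h' z)) (at z)"
    and h': "\<And>z. z \<in> V \<Longrightarrow> h' z = inv (blinfun_apply (\<Psi>' (h z)))"
    by metis
  have \<Psi>p: "\<Psi> p = 0"
    by (simp add: \<Psi>_def)
  have hp: "h 0 = p"
    using hom \<open>p \<in> U\<close> \<Psi>p by (metis homeomorphism_apply1)
  have h'0: "h' 0 = id"
    using h'[of 0] \<open>\<Psi> p \<in> V\<close> by (simp add: \<Psi>p hp \<Psi>'p id_def[symmetric])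
  have F_h: "F (h (t *\<^sub>R v)) = F p" if "t *\<^sub>R v \<in> V" for t
  proof -
    have "\<Psi> (h (t *\<^sub>R v)) = t *\<^sub>R v"
      using hom that by (metis homeomorphism_apply2)
    then have "F' p (\<Psi> (h (t *\<^sub>R v))) = 0"
      by (simp add: blinfun.scaleR_right v)
    then show ?thesis
      by (simp add: \<Psi>_def blinfun.diff_right blinfun.add_right FR)
  qed
  have "open ((\<lambda>t. t *\<^sub>R v) -` V)"
    by (intro open_vimage \<open>open V\<close> continuous_intros)
  moreover have "(0::real) \<in> (\<lambda>t. t *\<^sub>R v) -` V"
    using \<open>\<Psi> p \<in> V\<close> \<Psi>p by simp
  ultimately obtain \<epsilon> where "\<epsilon> > 0" and \<epsilon>: "ball (0::real) \<epsilon> \<subseteq> (\<lambda>t. t *\<^sub>R v) -` V"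
    using open_contains_ball by metis
  show ?thesis
  proof (rule that[of \<epsilon> "\<lambda>t. h (t *\<^sub>R v)"])
    show "\<epsilon> > 0" by fact
    show "h (0 *\<^sub>R v) = p" by (simp add: hp)
    have dlin: "((\<lambda>t. t *\<^sub>R v) has_derivative (\<lambda>s. s *\<^sub>R v)) (at t)" for t :: real
      by (auto intro!: derivative_eq_intros)
    have dcurve: "((\<lambda>t. h (t *\<^sub>R v)) has_derivative (\<lambda>s. h' (t *\<^sub>R v) (s *\<^sub>R v))) (at t)"
      if "t *\<^sub>R v \<in> V" for t
      using has_derivative_compose[OF dlin dh[OF that]] .
    show "((\<lambda>t. h (t *\<^sub>R v)) has_vector_derivative v) (at 0)"
      using dcurve[of 0] \<open>\<Psi> p \<in> V\<close> by (simp add: has_vector_derivative_def \<Psi>p h'0)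
    fix t assume "t \<in> {-\<epsilon><..<\<epsilon>}"
    then have "t \<in> ball 0 \<epsilon>"
      by (auto simp: dist_real_def)
    then have "t *\<^sub>R v \<in> V"
      using \<epsilon> by auto
    then show "F (h (t *\<^sub>R v)) = F p \<and> (\<lambda>t. h (t *\<^sub>R v)) differentiable (at t)"
      using F_h dcurve differentiableI by blast
  qed
qed

text \<open>Full row rank becomes the nonvanishing of one determinant that is continuous in the entries of
  \<open>A\<close>; regularity is thus an open condition, and the inverse Gram matrix is available for the
  formula of the projection.\<close>

lemma invertible_gram_iff_surj:
  fixes A :: "real^'n^'k"
  shows "invertible (A ** transpose A) \<longleftrightarrow> surj ((*v) A)"
proof
  assume "surj ((*v) A)"
  then have "inj ((*v) (transpose A))"
    by (simp add: full_rank_injective[symmetric] full_rank_surjective[symmetric] rank_transpose)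
  moreover have "transpose A *v w = 0" if "(A ** transpose A) *v w = 0" for w
  proof -
    have "(transpose A *v w) \<bullet> (transpose A *v w) = w \<bullet> ((A ** transpose A) *v w)"
      by (metis dot_lmul_matrix matrix_vector_mul_assoc transpose_matrix_vector)
    then show ?thesis
      using that by simp
  qed
  ultimately have "\<forall>w. (A ** transpose A) *v w = 0 \<longrightarrow> w = 0"
    by (metis injD matrix_vector_mult_0_right)
  then show "invertible (A ** transpose A)"
    by (simp add: invertible_left_inverse matrix_left_invertible_ker)
next
  assume "invertible (A ** transpose A)"
  then obtain B where "A ** (transpose A ** B) = mat 1"
    by (metis invertible_def matrix_mul_assoc)
  then show "surj ((*v) A)"
    using matrix_right_invertible_surjective by blast
qed

text \<open>Differentiating \<open>F \<circ> \<gamma> = F p\<close> puts every velocity into the kernel; conversely each kernel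
  vector is the velocity of the curve built in \<open>curve_in_level_set\<close>.\<close>

lemma tangent_space_level_set:
  fixes F :: "real^'n \<Rightarrow> real^'k"
  assumes "C2 F" and surj: "surj ((*v) (jacobian F (at p)))"
  shows "tangent_space {y. F y = F p} p = {v. jacobian F (at p) *v v = 0}"
proof (intro set_eqI iffI)
  fix v assume "v \<in> {v. jacobian F (at p) *v v = 0}"
  then have v: "jacobian F (at p) *v v = 0" by simp
  obtain F' F'' where d1: "\<And>y. (F has_derivative blinfun_apply (F' y)) (at y)"
    and d2: "\<And>y. (F' has_derivative blinfun_apply (F'' y)) (at y)"
    using \<open>C2 F\<close> unfolding C2_def by blast
  have F'p: "blinfun_apply (F' p) = (*v) (jacobian F (at p))"
    using d1 C2_has_derivative_jacobian[OF \<open>C2 F\<close>] has_derivative_unique by blast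
  have cont: "continuous_on UNIV F'"
    by (meson continuous_at_imp_continuous_on d2 has_derivative_continuous)
  obtain B where B: "jacobian F (at p) ** B = mat 1"
    using surj matrix_right_invertible_surjective by blast
  have "F' p o\<^sub>L Blinfun ((*v) B) = id_blinfun"
    by (rule blinfun_eqI)
       (simp add: F'p bounded_linear_Blinfun_apply matrix_vector_mul_assoc B)
  moreover have "F' p v = 0"
    by (simp add: F'p v)
  ultimately
  obtain \<gamma> \<epsilon> where "\<epsilon> > 0" "\<gamma> 0 = p" "(\<gamma> has_vector_derivative v) (at 0)"
    "\<And>t. t \<in> {-\<epsilon><..<\<epsilon>} \<Longrightarrow> F (\<gamma> t) = F p \<and> \<gamma> differentiable (at t)"
    using curve_in_level_set[OF d1 cont] by blast
  then show "v \<in> tangent_space {y. F y = F p} p"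
    unfolding tangent_space_def curve_through_def by blast
next
  fix v assume "v \<in> tangent_space {y. F y = F p} p"
  then obtain \<gamma> \<epsilon> where "\<epsilon> > 0" and \<gamma>: "\<gamma> 0 = p" "(\<gamma> has_vector_derivative v) (at 0)"
    "\<And>t. t \<in> {-\<epsilon><..<\<epsilon>} \<Longrightarrow> F (\<gamma> t) = F p"
    unfolding tangent_space_def curve_through_def by blast
  have "((\<lambda>t. F (\<gamma> t)) has_derivative (\<lambda>s. jacobian F (at p) *v (s *\<^sub>R v))) (at 0)"
    using has_derivative_compose[of \<gamma> "\<lambda>s. s *\<^sub>R v" 0 UNIV F "(*v) (jacobian F (at p))"] \<gamma>(1,2)
      C2_has_derivative_jacobian[OF \<open>C2 F\<close>]
    by (simp add: has_vector_derivative_def)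
  moreover have "((\<lambda>t. F (\<gamma> t)) has_derivative (\<lambda>s. 0)) (at 0)"
    by (rule has_derivative_transform_within_open[OF has_derivative_const[of "F p"],
          where s = "{-\<epsilon><..<\<epsilon>}"]) (use \<open>\<epsilon> > 0\<close> \<gamma>(3) in auto)
  ultimately have "(\<lambda>s::real. jacobian F (at p) *v (s *\<^sub>R v)) = (\<lambda>s. 0)"
    by (rule has_derivative_unique)
  from fun_cong[OF this, of 1] show "v \<in> {v. jacobian F (at p) *v v = 0}"
    by simp
qed

section \<open>Projection onto the kernel\<close>

text \<open>The inverse by Cramer's rule. As a quotient of polynomials in the entries it is visibly
  differentiable in them, which the abstract inverse is not.\<close>

definition cramer_inverse :: "real^'k^'k \<Rightarrow> real^'k^'k" where
  "cramer_inverse B =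
     (\<chi> i j. det (\<chi> a b. if b = i then (axis j 1 :: real^'k) $ a else B $ a $ b) / det B)"

lemma cramer_inverse_right:
  assumes "invertible B"
  shows "B ** cramer_inverse B = mat 1"
proof -
  have "B *v column j (cramer_inverse B) = axis j 1" for j
  proof -
    have "det B \<noteq> 0"
      using assms by (simp add: invertible_det_nz)
    then show ?thesis
      by (subst cramer) (simp_all add: cramer_inverse_def column_def vec_eq_iff)
  qed
  then have "(B ** cramer_inverse B) *v axis j 1 = axis j 1" for j
    by (metis matrix_vector_mul_assoc matrix_vector_mult_basis)
  then have "column j (B ** cramer_inverse B) = column j (mat 1)" for j
    by (metis matrix_vector_mult_basis matrix_vector_mul_lid)
  then show ?thesis
    by (simp add: column_def vec_eq_iff)
qed

text \<open>The usual closed form of the orthogonal projection onto the kernel of a matrix of full row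
  rank.\<close>

definition kernel_proj :: "real^'n^'k \<Rightarrow> real^'n^'n" where
  "kernel_proj A = mat 1 - transpose A ** cramer_inverse (A ** transpose A) ** A"

lemma mult_kernel_proj:
  assumes "surj ((*v) A)"
  shows "A *v (kernel_proj A *v u) = 0"
proof -
  have "A ** transpose A ** cramer_inverse (A ** transpose A) = mat 1"
    using assms by (simp add: cramer_inverse_right invertible_gram_iff_surj)
  then have "A ** (transpose A ** cramer_inverse (A ** transpose A) ** A) = A"
    by (metis matrix_mul_assoc matrix_mul_lid)
  then show ?thesis
    by (simp add: kernel_proj_def matrix_vector_mult_diff_rdistrib matrix_vector_mult_diff_distrib
        matrix_vector_mul_assoc)
qed

lemma orth_proj_matrix_eqI:
  assumes "subspace S" and P: "\<And>u. P *v u \<in> S" "\<And>u w. w \<in> S \<Longrightarrow> orthogonal (u - P *v u) w"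
  shows "orth_proj_matrix S = P"
  unfolding orth_proj_matrix_def
proof (rule the_equality)
  show "\<forall>u. P *v u \<in> S \<and> (\<forall>w\<in>S. orthogonal (u - P *v u) w)"
    using P by blast
  fix Q assume Q: "\<forall>u. Q *v u \<in> S \<and> (\<forall>w\<in>S. orthogonal (u - Q *v u) w)"
  have "Q *v u = P *v u" for u
  proof -
    let ?d = "Q *v u - P *v u"
    have "?d \<in> S"
      using Q P(1) \<open>subspace S\<close> by (simp add: subspace_diff)
    then have "(u - P *v u) \<bullet> ?d = 0" "(u - Q *v u) \<bullet> ?d = 0"
      using Q P(2) by (auto simp: orthogonal_def)
    then have "?d \<bullet> ?d = 0"
      by (simp add: inner_diff_left)
    then show ?thesis by simp
  qed
  then show "Q = P"
    by (simp add: matrix_eq)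
qed

text \<open>By \<open>mult_kernel_proj\<close> the values lie in the kernel; the residual \<open>u - P u\<close> lies in the range of
  \<open>A\<^sup>T\<close>, which is orthogonal to the kernel of \<open>A\<close>.\<close>

lemma orth_proj_matrix_kernel:
  fixes A :: "real^'n^'k"
  assumes "surj ((*v) A)"
  shows "orth_proj_matrix {v. A *v v = 0} = kernel_proj A"
proof (rule orth_proj_matrix_eqI)
  show "subspace {v. A *v v = 0}"
    by (simp add: linear_subspace_kernel)
  show "kernel_proj A *v u \<in> {v. A *v v = 0}" for u
    using mult_kernel_proj[OF assms] by simp
  fix u w assume "w \<in> {v. A *v v = 0}"
  then have w: "A *v w = 0" by simp
  have "u - kernel_proj A *v u = transpose A *v (cramer_inverse (A ** transpose A) *v (A *v u))"
    by (simp add: kernel_proj_def matrix_vector_mult_diff_rdistrib matrix_vector_mul_assoc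
        matrix_mul_assoc)
  moreover have "(transpose A *v z) \<bullet> w = z \<bullet> (A *v w)" for z
    by (metis dot_lmul_matrix transpose_matrix_vector)
  ultimately show "orthogonal (u - kernel_proj A *v u) w"
    by (simp add: orthogonal_def w)
qed

lemma kernel_proj_eq_self:
  "A *v v = 0 \<Longrightarrow> kernel_proj A *v v = v"
  by (simp add: kernel_proj_def matrix_vector_mult_diff_rdistrib matrix_vector_mul_assoc[symmetric])

lemma differentiable_matrix_mult:
  fixes X :: "'a::real_normed_vector \<Rightarrow> real^'n^'k" and Y :: "'a \<Rightarrow> real^'l^'n"
  assumes "X differentiable (at y)" and "Y differentiable (at y)"
  shows "(\<lambda>y. X y ** Y y) differentiable (at y)"
  using assms by (auto simp: differentiable_matrix_iff matrix_matrix_mult_def intro!: derivative_intros)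

lemma differentiable_transpose:
  fixes X :: "'a::real_normed_vector \<Rightarrow> real^'n^'k"
  assumes "X differentiable (at y)"
  shows "(\<lambda>y. transpose (X y)) differentiable (at y)"
  using assms by (simp add: differentiable_matrix_iff transpose_def)

lemma differentiable_det:
  fixes B :: "'a::real_normed_vector \<Rightarrow> real^'k^'k"
  assumes "B differentiable (at y)"
  shows "(\<lambda>y. det (B y)) differentiable (at y)"
proof -
  have "(\<lambda>y. \<Prod>i\<in>I. B y $ i $ q i) differentiable (at y)" if "finite I" for I q
    using that assms by induction (auto simp: differentiable_matrix_iff intro!: derivative_intros)
  then show ?thesis
    unfolding det_def by (auto intro!: derivative_intros)
qed

lemma cramer_inverse_differentiable:
  fixes B :: "'a::real_normed_vector \<Rightarrow> real^'k^'k"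
  assumes "B differentiable (at y)" and "invertible (B y)"
  shows "(\<lambda>y. cramer_inverse (B y)) differentiable (at y)"
proof -
  have "(\<lambda>y. \<chi> a b. if b = i then (axis j 1 :: real^'k) $ a else B y $ a $ b) differentiable (at y)"
    for i j
    using assms(1) unfolding differentiable_matrix_iff
    by (intro allI, rename_tac a b, case_tac "b = i") simp_all
  then have "(\<lambda>y. cramer_inverse (B y) $ i $ j) differentiable (at y)" for i j
    using assms unfolding cramer_inverse_def vec_lambda_beta invertible_det_nz
    by (intro differentiable_divide differentiable_det)
  then show ?thesis
    by (simp only: differentiable_matrix_iff) blast
qed

lemma kernel_proj_differentiable:
  fixes A :: "'a::real_normed_vector \<Rightarrow> real^'n^'k"
  assumes "A differentiable (at y)" and "surj ((*v) (A y))"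
  shows "(\<lambda>y. kernel_proj (A y)) differentiable (at y)"
  unfolding kernel_proj_def using assms
  by (intro differentiable_diff differentiable_const differentiable_matrix_mult
      differentiable_transpose cramer_inverse_differentiable)
     (simp_all add: invertible_gram_iff_surj)

lemma eventually_surj:
  fixes A :: "'a::real_normed_vector \<Rightarrow> real^'n^'k"
  assumes "A differentiable (at p)" and "surj ((*v) (A p))"
  shows "\<forall>\<^sub>F y in nhds p. surj ((*v) (A y))"
proof -
  have "isCont (\<lambda>y. det (A y ** transpose (A y))) p"
    by (rule differentiable_imp_continuous_within[OF differentiable_det[OF
          differentiable_matrix_mult[OF assms(1) differentiable_transpose[OF assms(1)]]]])
  moreover have "det (A p ** transpose (A p)) \<noteq> 0"
    using assms(2) by (simp add: invertible_gram_iff_surj invertible_det_nz[symmetric])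
  ultimately have "\<forall>\<^sub>F y in nhds p. det (A y ** transpose (A y)) \<noteq> 0"
    using tendsto_imp_eventually_ne[of _ "det (A p ** transpose (A p))"]
    unfolding isCont_def eventually_nhds_conv_at by blast
  then show ?thesis
    by (simp add: invertible_gram_iff_surj[symmetric] invertible_det_nz)
qed

section \<open>The second fundamental form of a level set\<close>

lemma has_derivative_eventually_eq:
  assumes "(f has_derivative D) (at p)" and "\<forall>\<^sub>F y in nhds p. f y = g y"
  shows "(g has_derivative D) (at p)"
  by (rule has_derivative_transform_eventually[OF assms(1)])
    (use assms(2) in \<open>simp_all add: eventually_nhds_conv_at\<close>)

text \<open>
  Along a curve in the level set, \<open>tangent_proj\<close> agrees near \<open>0\<close> with \<open>kernel_proj\<close> of the Jacobian,
  since the nearby points are still regular and lie on the same level set. The chain rule then gives the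
  derivative \<open>D v\<close> for every curve with velocity \<open>v\<close>. The description defining
  \<open>tangent_proj_deriv\<close> has no other solution because at least one such curve exists.
\<close>

lemma tangent_proj_deriv_level_set:
  fixes F :: "real^'n \<Rightarrow> real^'k"
  assumes "C2 F" and surj: "surj ((*v) (jacobian F (at p)))"
    and v: "jacobian F (at p) *v v = 0"
    and D: "((\<lambda>y. kernel_proj (jacobian F (at y))) has_derivative D) (at p)"
  shows "tangent_proj_deriv {y. F y = F p} p v = D v"
proof -
  let ?M = "{y. F y = F p}"
  have along: "((\<lambda>t. tangent_proj ?M (\<gamma> t)) has_vector_derivative D v) (at 0)"
    if \<gamma>: "curve_through ?M p v \<gamma>" for \<gamma>
  proof -
    obtain \<epsilon> where "\<epsilon> > 0" and in_M: "\<And>t. t \<in> {-\<epsilon><..<\<epsilon>} \<Longrightarrow> F (\<gamma> t) = F p"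
      using \<gamma> unfolding curve_through_def by blast
    have \<gamma>0: "\<gamma> 0 = p" and d\<gamma>: "(\<gamma> has_vector_derivative v) (at 0)"
      using \<gamma> unfolding curve_through_def by auto
    have "\<forall>\<^sub>F t in nhds 0. surj ((*v) (jacobian F (at (\<gamma> t))))"
    proof (rule eventually_compose_filterlim[where f = \<gamma> and F = "nhds p"])
      show "\<forall>\<^sub>F y in nhds p. surj ((*v) (jacobian F (at y)))"
        by (rule eventually_surj[OF C2_jacobian_differentiable[OF \<open>C2 F\<close>] surj])
      have "isCont \<gamma> 0"
        using d\<gamma> has_vector_derivative_continuous by blast
      then show "filterlim \<gamma> (nhds p) (nhds 0)"
        using \<gamma>0 by (metis tendsto_at_iff_tendsto_nhds isCont_def)
    qed
    moreover have "\<forall>\<^sub>F t in nhds 0. t \<in> {-\<epsilon><..<\<epsilon>}"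
      using \<open>\<epsilon> > 0\<close> by (intro eventually_nhds_in_open) auto
    ultimately have "\<forall>\<^sub>F t in nhds 0. kernel_proj (jacobian F (at (\<gamma> t))) = tangent_proj ?M (\<gamma> t)"
    proof eventually_elim
      case (elim t)
      then have "?M = {y. F y = F (\<gamma> t)}"
        using in_M by auto
      then show ?case
        using elim by (simp add: tangent_space_level_set[OF \<open>C2 F\<close>] orth_proj_matrix_kernel)
    qed
    moreover have "((\<lambda>t. kernel_proj (jacobian F (at (\<gamma> t)))) has_vector_derivative D v) (at 0)"
      unfolding has_vector_derivative_def
    proof -
      have "linear D"
        using D has_derivative_linear by blast
      then show "((\<lambda>t. kernel_proj (jacobian F (at (\<gamma> t)))) has_derivative (\<lambda>s. s *\<^sub>R D v)) (at 0)"
        using has_derivative_compose[of \<gamma> "\<lambda>s. s *\<^sub>R v" 0 UNIV _ D] d\<gamma> D \<gamma>0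
        by (simp add: has_vector_derivative_def linear_cmul)
    qed
    ultimately show ?thesis
      unfolding has_vector_derivative_def
      by (rule has_derivative_eventually_eq[rotated])
  qed
  obtain \<gamma>\<^sub>0 where \<gamma>\<^sub>0: "curve_through ?M p v \<gamma>\<^sub>0"
    using v tangent_space_level_set[OF \<open>C2 F\<close> surj] unfolding tangent_space_def by blast
  show ?thesis
    unfolding tangent_proj_deriv_def
  proof (rule the_equality)
    show "\<forall>\<gamma>. curve_through ?M p v \<gamma> \<longrightarrow>
        ((\<lambda>t. tangent_proj ?M (\<gamma> t)) has_vector_derivative D v) (at 0)"
      using along by blast
    show "E = D v" if "\<forall>\<gamma>. curve_through ?M p v \<gamma> \<longrightarrow>
        ((\<lambda>t. tangent_proj ?M (\<gamma> t)) has_vector_derivative E) (at 0)" for E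
      using vector_derivative_unique_at[OF that[rule_format, OF \<gamma>\<^sub>0] along[OF \<gamma>\<^sub>0]] .
  qed
qed

text \<open>A Weingarten identity: the normal component of the second fundamental form is read off from
  the derivative of any normal field. The proof differentiates the identity \<open>N y \<bullet> (P y v) = 0\<close>, in
  which \<open>v\<close> stays fixed while \<open>N\<close> and the projection \<open>P\<close> vary.\<close>

lemma normal_inner_second_fundamental_form:
  fixes F :: "real^'n \<Rightarrow> real^'k"
  assumes "C2 F" and surj: "surj ((*v) (jacobian F (at p)))"
    and v: "jacobian F (at p) *v v = 0"
    and normal: "\<And>y u. jacobian F (at y) *v u = 0 \<Longrightarrow> N y \<bullet> u = 0"
    and N': "(N has_derivative N') (at p)"
  shows "N p \<bullet> second_fundamental_form {y. F y = F p} p v v = - (v \<bullet> N' v)"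
proof -
  let ?P = "\<lambda>y. kernel_proj (jacobian F (at y))"
  note A = C2_jacobian_differentiable[OF \<open>C2 F\<close>, of p]
  obtain D where D: "(?P has_derivative D) (at p)"
    using kernel_proj_differentiable[OF A surj] unfolding differentiable_def by blast
  have bl: "bounded_linear (\<lambda>M :: real^'n^'n. M *v v)"
    unfolding linear_conv_bounded_linear[symmetric]
    by (rule linearI)
       (simp_all add: matrix_vector_mult_add_rdistrib scaleR_matrix_vector_assoc)
  have "((\<lambda>y. N y \<bullet> (?P y *v v)) has_derivative
      (\<lambda>h. N p \<bullet> (D h *v v) + N' h \<bullet> (?P p *v v))) (at p)"
    by (rule has_derivative_inner[OF N' bounded_linear.has_derivative[OF bl D]])
  moreover have "((\<lambda>y. N y \<bullet> (?P y *v v)) has_derivative (\<lambda>h. 0)) (at p)"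
  proof -
    have "\<forall>\<^sub>F y in nhds p. N y \<bullet> (?P y *v v) = 0"
      using eventually_surj[OF A surj]
      by eventually_elim (simp add: normal mult_kernel_proj)
    then have "\<forall>\<^sub>F y in nhds p. 0 = N y \<bullet> (?P y *v v)"
      by (simp only: eq_commute)
    then show ?thesis
      by (rule has_derivative_eventually_eq[OF has_derivative_const])
  qed
  ultimately have "(\<lambda>h. N p \<bullet> (D h *v v) + N' h \<bullet> (?P p *v v)) = (\<lambda>h. 0)"
    by (rule has_derivative_unique)
  from fun_cong[OF this, of v] have "N p \<bullet> (D v *v v) = - (N' v \<bullet> (?P p *v v))"
    by linarith
  also have "\<dots> = - (v \<bullet> N' v)"
    by (simp only: kernel_proj_eq_self[OF v] inner_commute)
  finally show ?thesis
    by (simp only: second_fundamental_form_def tangent_proj_deriv_level_set[OF \<open>C2 F\<close> surj v D])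
qed

theorem proposition3:
  fixes f :: "real^'n \<Rightarrow> real" and g :: "real^'n \<Rightarrow> real^'m"
    and x :: "real^'n" and l :: "real^'m"
  assumes "CARD('m) \<le> CARD('n)"
    and "C2 f" and "C2 g"
    and "regular_value g 0"
    and "local_min_on f {y. g y = 0} x"
    and "gradient f x \<noteq> 0"
    and "gradient f x - (\<Sum>i\<in>UNIV. l $ i *\<^sub>R gradient (\<lambda>y. g y $ i) x) = 0"
  shows "{v. jacobian g (at x) *v v = 0} = tangent_space {y. g y = 0} x \<and>
    ((\<forall>v\<in>{v. jacobian g (at x) *v v = 0}.
        v \<bullet> ((hessian f x - (\<Sum>i\<in>UNIV. l $ i *\<^sub>R hessian (\<lambda>y. g y $ i) x)) *v v) \<ge> 0)
     \<longleftrightarrow>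
     (\<forall>v\<in>{v. jacobian g (at x) *v v = 0}.
        unit_normal f x \<bullet> second_fundamental_form {y. f y = f x} x v v
          \<le> unit_normal f x \<bullet> second_fundamental_form {y. g y = 0} x v v))"
proof -
  have gx: "g x = 0"
    using assms(5) by (simp add: local_min_on_def)
  let ?Hg = "\<Sum>i\<in>UNIV. l $ i *\<^sub>R hessian (\<lambda>y. g y $ i) x"
  \<comment> \<open>The multipliers stay constant while the base point moves, so at every \<open>y\<close>
    the vector \<open>N y\<close> is orthogonal to the kernel of the Jacobian of \<open>g\<close>. The multiplier equation
    identifies \<open>N\<close> with the gradient of \<open>f\<close> at the point \<open>x\<close>.\<close>
  define N where "N y = (\<Sum>i\<in>UNIV. l $ i *\<^sub>R gradient (\<lambda>y. g y $ i) y)" for y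
  have Nx: "N x = gradient f x"
    using assms(7) by (simp add: N_def)
  have surj_g: "surj ((*v) (jacobian g (at x)))"
    using assms(4) gx by (simp add: regular_value_def full_rank_surjective)
  have N_normal: "N y \<bullet> u = 0" if "jacobian g (at y) *v u = 0" for y u
  proof -
    have "gradient (\<lambda>y. g y $ i) y \<bullet> u = 0" for i
      using that by (metis gradient_component[OF \<open>C2 g\<close>] matrix_vector_mul_component zero_index)
    then show ?thesis
      by (simp add: N_def inner_sum_left)
  qed
  have "(N has_derivative (\<lambda>h. \<Sum>i\<in>UNIV. l $ i *\<^sub>R (hessian (\<lambda>y. g y $ i) x *v h))) (at x)"
    unfolding N_def
    by (rule has_derivative_sum has_derivative_scaleR_right gradient_component_has_derivative \<open>C2 g\<close>)+
  moreover have "(\<Sum>i\<in>UNIV. l $ i *\<^sub>R (hessian (\<lambda>y. g y $ i) x *v h)) = ?Hg *v h" for h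
  proof -
    have "(\<Sum>i\<in>I. M i) *v h = (\<Sum>i\<in>I. M i *v h)" if "finite I" for M :: "'m \<Rightarrow> real^'n^'n" and I
      using that by induction (auto simp: matrix_vector_mult_add_rdistrib)
    then show ?thesis
      by (simp add: scaleR_matrix_vector_assoc)
  qed
  ultimately have N': "(N has_derivative (*v) ?Hg) (at x)"
    by simp
  have second_g: "gradient f x \<bullet> second_fundamental_form {y. g y = 0} x v v = - (v \<bullet> (?Hg *v v))"
    if "jacobian g (at x) *v v = 0" for v
    using normal_inner_second_fundamental_form[OF \<open>C2 g\<close> surj_g that N_normal N'] gx Nx by simp

  define F :: "real^'n \<Rightarrow> real^1" where "F y = vec (f y)" for y
  have "bounded_linear (vec :: real \<Rightarrow> real^1)"
    unfolding linear_conv_bounded_linear[symmetric] by (rule linearI) (simp_all add: vec_eq_iff)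
  then have "C2 F"
    unfolding F_def by (rule C2_bounded_linear_compose[OF _ \<open>C2 f\<close>])
  have f_eq: "(\<lambda>y. F y $ 1) = f"
    by (simp add: F_def)
  have level_f: "{y. F y = F x} = {y. f y = f x}"
    by (auto simp: F_def vec_eq_iff)
  have jac_F: "jacobian F (at y) *v u = vec (gradient f y \<bullet> u)" for y u
    using gradient_component[OF \<open>C2 F\<close>, of 1 y, unfolded f_eq]
    by (simp add: vec_eq_iff[of "_ *v _"] forall_1 matrix_vector_mul_component)
  have surj_f: "surj ((*v) (jacobian F (at x)))"
  proof (rule surjI)
    let ?d = "gradient f x"
    show "jacobian F (at x) *v ((w $ 1 / (?d \<bullet> ?d)) *\<^sub>R ?d) = w" for w
      using assms(6) by (simp add: jac_F vec_eq_iff forall_1)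
  qed
  have f'': "(gradient f has_derivative (*v) (hessian f x)) (at x)"
    using gradient_component_has_derivative[OF \<open>C2 F\<close>, of 1] by (simp add: f_eq)
  have f_normal: "gradient f y \<bullet> u = 0" if "jacobian F (at y) *v u = 0" for y u
    using that by (simp add: jac_F vec_eq_iff)
  have second_f: "gradient f x \<bullet> second_fundamental_form {y. f y = f x} x v v
      = - (v \<bullet> (hessian f x *v v))" if "jacobian g (at x) *v v = 0" for v
  proof -
    have "jacobian F (at x) *v v = 0"
      using N_normal[OF that] by (simp add: jac_F Nx vec_eq_iff)
    from normal_inner_second_fundamental_form[OF \<open>C2 F\<close> surj_f this f_normal f'']
    show ?thesis
      by (simp only: level_f)
  qed

  have "v \<bullet> ((hessian f x - ?Hg) *v v) \<ge> 0 \<longleftrightarrow>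
      unit_normal f x \<bullet> second_fundamental_form {y. f y = f x} x v v
        \<le> unit_normal f x \<bullet> second_fundamental_form {y. g y = 0} x v v"
    if "jacobian g (at x) *v v = 0" for v
  proof -
    have "inverse (norm (gradient f x)) > 0"
      using assms(6) by simp
    then show ?thesis
      by (simp add: unit_normal_def second_f[OF that] second_g[OF that]
          matrix_vector_mult_diff_rdistrib inner_diff_right mult_le_cancel_left_pos)
  qed
  moreover have "{v. jacobian g (at x) *v v = 0} = tangent_space {y. g y = 0} x"
    using tangent_space_level_set[OF \<open>C2 g\<close> surj_g] gx by simp
  ultimately show ?thesis
    by blast
qed

end
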